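(* Let $K$ be a positive integer and let $\lambda>0$ be such that $1/\lambda$ is an integer with $4\mid (1/\lambda)$ and $(1/\lambda)\mid K$. Write $K=\prod_{p\text{ prime}}p^{n_{K,p}}$ and suppose that $n_{K,2}\le 7$ and $n_{K,p}\le 1$ for every prime $p\ne 2$. Let $f(x)=f_1x+f_2x^2 \pmod K$ be a quadratic permutation polynomial (QPP) over $\mathbb{Z}_K$ with a quadratic inverse. Consider the binary 3-dimensional turbo code (3D-TC) of information length $K$ with permeability rate $\lambda$, regular puncturing pattern $\mathbf p=[1100\cdots00]$ of period $2/\lambda$, interleaver generated by $f$, tailbiting upper and lower constituent encoders with feedforward polynomial $1+D+D^3$ and feedback polynomial $1+D^2+D^3$, and any patch whose encoder maps the all-zero sequence to the all-zero sequence. Then the minimum distance of this 3D-TC is at most $67$.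
   Context: QPPs. For an integer $M\ge 2$ and nonnegative integers $f_1,f_2$, the polynomial $f(x)=f_1x+f_2x^2\pmod M$ is a quadratic permutation polynomial (QPP) over $\mathbb{Z}_M$ if it permutes $\{0,1,\dots,M-1\}$. It has a quadratic inverse if the inverse permutation is also generated by a QPP $g(x)=g_1x+g_2x^2\pmod M$. Tailbiting constituent code. Sequences of length $K$ over $\mathbb{F}_2$ are indexed by $\mathbb{Z}_K=\{0,\dots,K-1\}$. With tailbiting termination (initial trellis state equals final trellis state) and generator $(1+D+D^3)/(1+D^2+D^3)$, a pair (input $\mathbf v$, parity output $\mathbf y$) of length-$K$ binary sequences is valid if there is a binary sequence $(s_t)_{t\in\mathbb{Z}_K}$ with $v_t=s_t+s_{t-2}+s_{t-3}$ and $y_t=s_t+s_{t-1}+s_{t-3}$ over $\mathbb{F}_2$ for all $t$, indices modulo $K$. 3D-TC. The information sequence is $\mathbf u\in\mathbb{F}_2^K$. The interleaved sequence $\mathbf u'$ is given by $u'_{f(i)}=u_i$ for $i\in\mathbb{Z}_K$. The upper parity sequence $\mathbf x_a$ and the lower parity sequence $\mathbf x_b$ are such that $(\mathbf u,\mathbf x_a)$ and $(\mathbf u',\mathbf x_b)$ are valid pairs. Form the alternating sequence $\mathbf x^{\mathrm{TC}}=(x_{a,0},x_{b,0},x_{a,1},x_{b,1},\dots)$. The regular puncturing pattern $\mathbf p=[1100\cdots00]$ of period $2/\lambda$, applied periodically to $\mathbf x^{\mathrm{TC}}$, selects the bits $x_{a,i},x_{b,i}$ with $i\equiv 0\pmod{1/\lambda}$.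 These form, in order, the sequence $\mathbf x^{\mathrm p}$ of length $N_c=2\lambda K$. The remaining bits of $\mathbf x^{\mathrm{TC}}$ form the sequence $\mathbf x^{\mathrm{ch}}$ of length $2K-N_c$. The patch is an arbitrary permutation $\Pi_c$ of the $N_c$ positions of $\mathbf x^{\mathrm p}$ followed by an arbitrary rate-1 encoder, i.e. an encoding map $\mathbb{F}_2^{N_c}\to\mathbb{F}_2^{N_c}$, subject only to mapping the all-zero sequence to the all-zero sequence. Its output is $\mathbf x_c$. The 3D-TC is the set of all words $(\mathbf u,\mathbf x^{\mathrm{ch}},\mathbf x_c)\in\mathbb{F}_2^{3K}$ obtained this way, and its minimum distance is the minimum Hamming distance between two distinct codewords. *)

theory Defs
  imports
    Complex_Main
    "HOL-Library.Z2"
    "HOL-Library.Extended_Nat"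
    "HOL-Combinatorics.Permutations"
    "HOL-Computational_Algebra.Primes"
begin

text \<open>Binary sequences are lists over the two-element field \<^typ>\<open>bit\<close>.\<close>

definition quad_map :: "nat \<Rightarrow> nat \<Rightarrow> nat \<Rightarrow> nat \<Rightarrow> nat" where
  "quad_map M f1 f2 x = (f1 * x + f2 * x\<^sup>2) mod M"

definition is_QPP :: "nat \<Rightarrow> nat \<Rightarrow> nat \<Rightarrow> bool" where
  "is_QPP M f1 f2 \<longleftrightarrow> M \<ge> 2 \<and> bij_betw (quad_map M f1 f2) {..<M} {..<M}"

definition has_quadratic_inverse :: "nat \<Rightarrow> nat \<Rightarrow> nat \<Rightarrow> bool" where
  "has_quadratic_inverse M f1 f2 \<longleftrightarrow>
    (\<exists>g1 g2. is_QPP M g1 g2 \<and>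
       (\<forall>x<M. quad_map M g1 g2 (quad_map M f1 f2 x) = x \<and>
              quad_map M f1 f2 (quad_map M g1 g2 x) = x))"

definition cyc_nth :: "'a list \<Rightarrow> int \<Rightarrow> 'a" where
  "cyc_nth s i = s ! nat (i mod int (length s))"

text \<open>Input/output pairs of the tailbiting encoder with generator
  $(1+D+D^3)/(1+D^2+D^3)$. The sequence \<open>s\<close> lists the bits fed into the shift
  register; it is indexed cyclically because the initial and final states coincide. The
  relation is not a function of \<open>v\<close> in general: if 7 divides \<open>K\<close>, a given \<open>v\<close> may have
  several or no outputs \<open>y\<close>.\<close>

definition tailbiting_pair :: "nat \<Rightarrow> bit list \<Rightarrow> bit list \<Rightarrow> bool" where
  "tailbiting_pair K v y \<longleftrightarrow> length v = K \<and> length y = K \<and>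
    (\<exists>s. length s = K \<and>
      (\<forall>t<K. v ! t = cyc_nth s (int t) + cyc_nth s (int t - 2) + cyc_nth s (int t - 3) \<and>
             y ! t = cyc_nth s (int t) + cyc_nth s (int t - 1) + cyc_nth s (int t - 3)))"

definition interleaved :: "nat \<Rightarrow> (nat \<Rightarrow> nat) \<Rightarrow> 'a list \<Rightarrow> 'a list \<Rightarrow> bool" where
  "interleaved K f u u' \<longleftrightarrow> length u = K \<and> length u' = K \<and> (\<forall>i<K. u' ! f i = u ! i)"

text \<open>Here and below, \<open>q\<close> stands for the inverse permeability rate $1/\lambda$, so the
  pattern has period $2q$.\<close>

definition regular_pattern :: "nat \<Rightarrow> bit list" where
  "regular_pattern q = [1, 1] @ replicate (2 * q - 2) 0"

definition selected :: "bit list \<Rightarrow> 'a list \<Rightarrow> 'a list" where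
  "selected p x = nths x {j. p ! (j mod length p) = 1}"

definition unselected :: "bit list \<Rightarrow> 'a list \<Rightarrow> 'a list" where
  "unselected p x = nths x {j. p ! (j mod length p) = 0}"

text \<open>Neither linearity nor injectivity is required of the encoder of the patch.\<close>

definition patch_encoder :: "nat \<Rightarrow> (bit list \<Rightarrow> bit list) \<Rightarrow> bool" where
  "patch_encoder N E \<longleftrightarrow>
    (\<forall>x. length x = N \<longrightarrow> length (E x) = N) \<and> E (replicate N 0) = replicate N 0"

definition turbo_code_3D ::
    "nat \<Rightarrow> nat \<Rightarrow> (nat \<Rightarrow> nat) \<Rightarrow> (nat \<Rightarrow> nat) \<Rightarrow> (bit list \<Rightarrow> bit list) \<Rightarrow> bit list set" where
  "turbo_code_3D K q f \<pi> E =
    {u @ unselected (regular_pattern q) (splice xa xb)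
       @ E (permute_list \<pi> (selected (regular_pattern q) (splice xa xb))) | u u' xa xb.
       interleaved K f u u' \<and> tailbiting_pair K u xa \<and> tailbiting_pair K u' xb}"

definition hamming_distance :: "'a list \<Rightarrow> 'a list \<Rightarrow> nat" where
  "hamming_distance x y = card {i. i < length x \<and> x ! i \<noteq> y ! i}"

text \<open>The value is \<open>\<infinity>\<close> for a code with fewer than two words, so a finite upper bound
  asserts in particular that two distinct codewords exist.\<close>

definition minimum_distance :: "'a list set \<Rightarrow> enat" where
  "minimum_distance C =
    Inf {enat (hamming_distance c c') | c c'. c \<in> C \<and> c' \<in> C \<and> c \<noteq> c'}"

end

theory Submission
  imports Defs "HOL-Number_Theory.Cong"
begin

section \<open>Low-weight words of the turbo code\<close>

text \<open>Since the patch fixes zero, it suffices to find a nonzero input of small weight whose upper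
  and lower parities both vanish at the positions divisible by 4. The input triple
  \<open>{c, c + 1, c + 5}\<close> has parity \<open>{c, c + 4, c + 5}\<close>, which avoids these positions if
  \<open>c mod 4\<close> is 1 or 2. So one needs a set of positions that is a sum of such triples both before
  and after interleaving. In polyphase form (modulo 4) a sum of triples lying in the classes 1, 2, 3
  is a triple \<open>(P1, P2, P3)\<close> of group ring elements with
  \<open>(1 + z^2) P1 + (1 + z) P2 + P3 = 0\<close>, where \<open>z\<close> is the shift by 4. The hypotheses on \<open>K\<close>
  and \<open>f\<close> make \<open>f\<close> additive enough for the lower condition to have the same form in the shift
  induced by the interleaver, with \<open>P1\<close> and \<open>P3\<close> exchanged if \<open>f1 + f2\<close> is 3 modulo 4. The
  cross product of the two coefficient vectors solves both equations; its weight is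
  \<open>16 + 24 + 24 = 64\<close> without and \<open>17 + 25 + 25 = 67\<close> with the exchange. In the second case the
  input is nonzero because 17 is odd. In the first case it is nonzero if \<open>P2\<close> is; if \<open>P2 = 0\<close>,
  the solution \<open>(1, 0, 1 + z^2)\<close> of the upper condition also satisfies the lower one.\<close>

section \<open>Hamming weight of binary lists\<close>

definition weight :: "bit list \<Rightarrow> nat" where
  "weight xs = length (filter (\<lambda>b. b \<noteq> 0) xs)"

lemma weight_simps [simp]:
  "weight [] = 0"
  "weight (b # xs) = (if b = 0 then weight xs else Suc (weight xs))"
  "weight (xs @ ys) = weight xs + weight ys"
  "weight (replicate n 0) = 0"
  by (auto simp: weight_def simp del: bit_not_zero_iff)

lemma weight_splice: "weight (splice xs ys) = weight xs + weight ys"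
  by (induction xs ys rule: splice.induct) auto

lemma weight_nths_le: "weight (nths xs A) \<le> weight xs"
proof (induction xs arbitrary: A)
  case (Cons x xs)
  then show ?case
    using Cons[of "{j. Suc j \<in> A}"] by (auto simp: nths_Cons le_SucI)
qed simp

lemma hamming_distance_replicate:
  assumes "length xs = n"
  shows "hamming_distance (replicate n 0) xs = weight xs"
proof -
  have "{i. i < n \<and> replicate n 0 ! i \<noteq> xs ! i} = {i. i < length xs \<and> xs ! i \<noteq> 0}"
    using assms by auto
  then show ?thesis
    by (simp add: hamming_distance_def weight_def length_filter_conv_card)
qed

lemma splice_nth:
  assumes "length xs = length ys" "j < 2 * length xs"
  shows "splice xs ys ! j = (if even j then xs ! (j div 2) else ys ! (j div 2))"
  using assms
proof (induction xs arbitrary: ys j)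
  case (Cons x xs)
  then obtain y ys' where ys: "ys = y # ys'" by (cases ys) auto
  show ?case
  proof (cases "j < 2")
    case True
    then have "j = 0 \<or> j = 1" by auto
    then show ?thesis by (auto simp: ys)
  next
    case False
    then obtain i where "j = Suc (Suc i)"
      by (metis add_2_eq_Suc not_less nat_le_iff_add)
    then show ?thesis using Cons by (auto simp: ys)
  qed
qed simp

section \<open>Puncturing of the alternating sequence\<close>

lemma regular_pattern_nth:
  assumes "q \<ge> 1"
  shows "regular_pattern q ! (j mod length (regular_pattern q)) = 1 \<longleftrightarrow> j mod (2 * q) < 2"
proof -
  have len: "length (regular_pattern q) = 2 * q"
    using assms by (simp add: regular_pattern_def)
  have "j mod (2 * q) < 2 * q" using assms by simp
  moreover have "regular_pattern q ! i = 1 \<longleftrightarrow> i < 2" if "i < 2 * q" for i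
    using that by (cases i; cases "i - 1") (simp_all add: regular_pattern_def)
  ultimately show ?thesis by (simp add: len)
qed

lemma card_residues_less_2:
  assumes "q \<ge> 1"
  shows "card {j. j < 2 * q * k \<and> j mod (2 * q) < 2} = 2 * k"
proof (induction k)
  case (Suc k)
  have eq: "{j. j < 2 * q * Suc k \<and> j mod (2 * q) < 2} =
    {j. j < 2 * q * k \<and> j mod (2 * q) < 2} \<union> {2 * q * k, 2 * q * k + 1}" (is "?L = ?A \<union> ?B")
  proof (intro set_eqI iffI)
    fix j assume j: "j \<in> ?L"
    show "j \<in> ?A \<union> ?B"
    proof (cases "j < 2 * q * k")
      case False
      then obtain i where i: "j = 2 * q * k + i" by (metis le_iff_add not_less)
      then have "i < 2 * q" using j by simp
      then have "i < 2" using j i by simp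
      then show ?thesis using i by (auto simp: less_2_cases_iff)
    qed (use j in auto)
  next
    fix j assume "j \<in> ?A \<union> ?B"
    moreover have "(2 * q * k + 1) mod (2 * q) = 1"
      unfolding mod_mult_self4 using assms by simp
    ultimately show "j \<in> ?L" using assms by auto
  qed
  have "card (?A \<union> ?B) = card ?A + card ?B"
    by (rule card_Un_disjoint) auto
  then show ?case using Suc eq by simp
qed simp

lemma selected_splice_eq_replicate:
  assumes len: "length xa = K" "length xb = K" and q: "q \<ge> 1" "K = q * k"
    and zero: "\<And>i. i < K \<Longrightarrow> q dvd i \<Longrightarrow> xa ! i = 0 \<and> xb ! i = 0"
  shows "selected (regular_pattern q) (splice xa xb) = replicate (2 * k) 0"
proof -
  let ?J = "{j. regular_pattern q ! (j mod length (regular_pattern q)) = 1}"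
  have J: "?J = {j. j mod (2 * q) < 2}"
    using regular_pattern_nth[OF q(1)] by simp
  have "length (nths (splice xa xb) ?J) = card {j. j < 2 * q * k \<and> j mod (2 * q) < 2}"
    unfolding length_nths J using len q(2)
    by (simp add: mult_2 distrib_right del: mod_less)
  then have 1: "length (nths (splice xa xb) ?J) = 2 * k"
    using card_residues_less_2[OF q(1)] by simp
  have 2: "b = 0" if "b \<in> set (nths (splice xa xb) ?J)" for b
  proof -
    from that obtain j where j: "j < 2 * K" "j mod (2 * q) < 2" "b = splice xa xb ! j"
      unfolding J set_nths using len by (auto simp: mult_2)
    have b: "b = (if even j then xa ! (j div 2) else xb ! (j div 2))"
      using j(3) splice_nth[of xa xb j] j(1) len by simp
    \<comment> \<open>\<open>j div 2\<close> is the index into \<open>xa\<close> or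
      \<open>xb\<close> and the parity of \<open>j\<close> tells which; the pattern keeps exactly
      the indices divisible by \<open>q\<close>.\<close>
    have "j mod (2 * q) = 2 * (j div 2 mod q) + j mod 2"
      by (rule mod_mult2_eq)
    then have "j div 2 mod q = 0" using j(2) by linarith
    then have "q dvd j div 2" by (simp add: dvd_eq_mod_eq_0)
    then show ?thesis using zero[of "j div 2"] b j(1) by auto
  qed
  show ?thesis
    unfolding selected_def using 1 2 by (metis replicate_eqI)
qed

text \<open>The comparison is with the zero codeword. All bits entering the patch vanish, so its
  output is zero for every permutation and every, possibly nonlinear, encoder.\<close>

lemma turbo_code_minimum_distance_le:
  assumes q: "q \<ge> 1" "K = q * k" and \<pi>: "\<pi> permutes {..<2 * k}"
    and E: "patch_encoder (2 * k) E"
    and il: "interleaved K f u u'"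
    and tb: "tailbiting_pair K u xa" "tailbiting_pair K u' xb"
    and f: "\<And>i. i < K \<Longrightarrow> f i < K"
    and zero: "\<And>i. i < K \<Longrightarrow> q dvd i \<Longrightarrow> xa ! i = 0 \<and> xb ! i = 0"
    and nz: "u \<noteq> replicate K 0"
    and wt: "weight u + weight xa + weight xb \<le> w"
  shows "minimum_distance (turbo_code_3D K q f \<pi> E) \<le> enat w"
proof -
  let ?P = "regular_pattern q"
  let ?cw = "\<lambda>u xa xb. u @ unselected ?P (splice xa xb)
       @ E (permute_list \<pi> (selected ?P (splice xa xb)))"
  let ?z = "replicate K 0"
  have len: "length u = K" "length xa = K" "length xb = K"
    using il tb by (auto simp: interleaved_def tailbiting_pair_def)
  have cyc0: "cyc_nth (replicate K 0) i = 0" if "K > 0" for i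
    unfolding cyc_nth_def using that by (simp add: nat_less_iff)
  have tz: "tailbiting_pair K ?z ?z"
    unfolding tailbiting_pair_def using cyc0
    by (intro conjI exI[of _ ?z]) (auto simp: cyc0)
  have iz: "interleaved K f ?z ?z" using f by (auto simp: interleaved_def)
  have perm: "permute_list \<pi> (replicate (2 * k) 0) = replicate (2 * k) (0 :: bit)"
  proof (rule replicate_eqI)
    fix y assume "y \<in> set (permute_list \<pi> (replicate (2 * k) (0 :: bit)))"
    then show "y = 0" using permutes_in_image[OF \<pi>] by (auto simp: permute_list_def)
  qed simp
  have third: "E (permute_list \<pi> (selected ?P (splice ya yb))) = replicate (2 * k) 0"
    if "length ya = K" "length yb = K" "\<And>i. i < K \<Longrightarrow> q dvd i \<Longrightarrow> ya ! i = 0 \<and> yb ! i = 0" for ya yb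
    using selected_splice_eq_replicate[OF that(1,2) q that(3)] perm E
    by (simp add: patch_encoder_def)
  have third0: "E (permute_list \<pi> (selected ?P (splice ?z ?z))) = replicate (2 * k) 0"
    by (rule third) auto
  have thirdx: "E (permute_list \<pi> (selected ?P (splice xa xb))) = replicate (2 * k) 0"
    using third len zero by blast
  have unsel_len: "length (unselected ?P (splice ?z ?z)) = length (unselected ?P (splice xa xb))"
    unfolding unselected_def length_nths using len by simp
  have unsel0: "unselected ?P (splice ?z ?z) = replicate (length (unselected ?P (splice xa xb))) 0"
    using unsel_len
    by (intro replicate_eqI) (auto simp: unselected_def dest!: in_set_nthsD)
  have "?cw ?z ?z ?z = replicate (length (?cw u xa xb)) 0"
    unfolding unsel0 third0 thirdx length_append len length_replicate replicate_add by simp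
  then have "hamming_distance (?cw ?z ?z ?z) (?cw u xa xb) = weight (?cw u xa xb)"
    by (simp only: hamming_distance_replicate)
  also have "\<dots> = weight u + weight (unselected ?P (splice xa xb))"
    by (simp add: thirdx)
  also have "\<dots> \<le> weight u + weight xa + weight xb"
    using weight_nths_le[of "splice xa xb"] by (simp add: unselected_def weight_splice)
  finally have hd: "hamming_distance (?cw ?z ?z ?z) (?cw u xa xb) \<le> w" using wt by simp
  have "?cw ?z ?z ?z \<in> turbo_code_3D K q f \<pi> E" "?cw u xa xb \<in> turbo_code_3D K q f \<pi> E"
    unfolding turbo_code_3D_def using tz iz il tb by blast+
  moreover have "?cw ?z ?z ?z \<noteq> ?cw u xa xb" using nz len by auto
  ultimately have "minimum_distance (turbo_code_3D K q f \<pi> E)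
      \<le> enat (hamming_distance (?cw ?z ?z ?z) (?cw u xa xb))"
    unfolding minimum_distance_def by (intro Inf_lower) blast
  also have "\<dots> \<le> enat w" using hd by simp
  finally show ?thesis .
qed

section \<open>Periodic binary sequences\<close>

declare add_bit_eq_xor [simp del]

lemma bit_add_self [simp]: "a + a = (0 :: bit)" "a + (a + b) = (b :: bit)"
  by (cases a; cases b; simp)+

lemmas bit_add_ac = add.assoc[where 'a = bit] add.left_commute[where 'a = bit]
  add.commute[where 'a = bit]

lemma bit_add_eq_0_iff: "a + b = 0 \<longleftrightarrow> a = (b :: bit)"
  by (cases a; cases b; simp)

definition pulse :: "nat \<Rightarrow> int \<Rightarrow> int \<Rightarrow> bit" where
  "pulse K p t = of_bool ([p = t] (mod int K))"

text \<open>A list of positions stands for an element of the group ring over \<open>bit\<close> of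
  the integers modulo \<open>K\<close>: order is irrelevant and equal positions cancel in
  pairs.\<close>

definition pulses :: "nat \<Rightarrow> int list \<Rightarrow> int \<Rightarrow> bit" where
  "pulses K ps t = (\<Sum>p\<leftarrow>ps. pulse K p t)"

definition word :: "nat \<Rightarrow> (int \<Rightarrow> bit) \<Rightarrow> bit list" where
  "word K \<phi> = map (\<lambda>i. \<phi> (int i)) [0..<K]"

lemma pulses_simps [simp]:
  "pulses K [] t = 0"
  "pulses K (p # ps) t = pulse K p t + pulses K ps t"
  "pulses K (ps @ ps') t = pulses K ps t + pulses K ps' t"
  by (simp_all add: pulses_def)

lemma pulse_cong: "[p = p'] (mod int K) \<Longrightarrow> pulse K p t = pulse K p' t"
  unfolding pulse_def by (simp add: cong_def)

lemma pulse_cong_arg: "[t = t'] (mod int K) \<Longrightarrow> pulse K p t = pulse K p t'"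
  unfolding pulse_def by (simp add: cong_def)

lemma pulses_cong_arg: "[t = t'] (mod int K) \<Longrightarrow> pulses K ps t = pulses K ps t'"
  by (induction ps) (auto simp: pulse_cong_arg[of t t'])

lemma pulses_cong:
  "list_all2 (\<lambda>p p'. [p = p'] (mod int K)) ps ps' \<Longrightarrow> pulses K ps t = pulses K ps' t"
  by (induction rule: list_all2_induct) (auto dest: pulse_cong)

lemma pulse_eq_0:
  assumes "4 dvd int K" "p mod 4 \<noteq> t mod 4"
  shows "pulse K p t = 0"
proof -
  have "\<not> [p = t] (mod int K)"
    using cong_dvd_modulus[of p t "int K" 4] assms by (auto simp: cong_def)
  then show ?thesis by (simp add: pulse_def)
qed

lemma pulse_shift: "pulse K p (t - d) = pulse K (p + d) t"
proof -
  have "[p = t - d] (mod int K) \<longleftrightarrow> [p + d = t] (mod int K)"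
    by (simp add: cong_iff_dvd_diff algebra_simps)
  then show ?thesis by (simp add: pulse_def)
qed

lemma pulses_shift: "pulses K ps (t - d) = pulses K (map (\<lambda>p. p + d) ps) t"
  by (induction ps) (auto simp: pulse_shift)

lemma length_word [simp]: "length (word K \<phi>) = K"
  by (simp add: word_def)

lemma nth_word [simp]: "i < K \<Longrightarrow> word K \<phi> ! i = \<phi> (int i)"
  by (simp add: word_def)

lemma cyc_nth_word:
  assumes "K > 0" and "\<And>t t'. [t = t'] (mod int K) \<Longrightarrow> \<phi> t = \<phi> t'"
  shows "cyc_nth (word K \<phi>) t = \<phi> t"
proof -
  have "nat (t mod int K) < K" using assms(1) by (simp add: nat_less_iff)
  then have "cyc_nth (word K \<phi>) t = \<phi> (t mod int K)"
    using assms(1) by (simp add: cyc_nth_def)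
  also have "\<dots> = \<phi> t" by (rule assms(2)) (simp add: cong_def)
  finally show ?thesis .
qed

lemma weight_word: "weight (word K \<phi>) = card {i. i < K \<and> \<phi> (int i) \<noteq> 0}"
  unfolding weight_def length_filter_conv_card length_word
  by (rule arg_cong[where f = card]) (auto simp del: bit_not_zero_iff)

text \<open>Positions that coincide modulo \<open>K\<close> only cancel, so weights are bounded
  without checking distinctness.\<close>

lemma weight_word_pulses: "K > 0 \<Longrightarrow> weight (word K (pulses K ps)) \<le> length ps"
proof (induction ps)
  case (Cons p ps)
  have "{i. i < K \<and> pulses K (p # ps) (int i) \<noteq> 0}
    \<subseteq> insert (nat (p mod int K)) {i. i < K \<and> pulses K ps (int i) \<noteq> 0}"
  proof
    fix i assume "i \<in> {i. i < K \<and> pulses K (p # ps) (int i) \<noteq> 0}"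
    then have i: "i < K" "pulse K p (int i) + pulses K ps (int i) \<noteq> 0" by auto
    show "i \<in> insert (nat (p mod int K)) {i. i < K \<and> pulses K ps (int i) \<noteq> 0}"
    proof (cases "pulse K p (int i) = 0")
      case False
      then have "p mod int K = int i" using i(1) by (auto simp: pulse_def cong_def)
      then show ?thesis by simp
    qed (use i in auto)
  qed
  then have "card {i. i < K \<and> pulses K (p # ps) (int i) \<noteq> 0}
    \<le> card (insert (nat (p mod int K)) {i. i < K \<and> pulses K ps (int i) \<noteq> 0})"
    by (intro card_mono) auto
  also have "\<dots> \<le> Suc (card {i. i < K \<and> pulses K ps (int i) \<noteq> 0})"
    by (rule card_insert_le_m1) auto
  also have "\<dots> \<le> length (p # ps)"
    using Cons by (simp add: weight_word)
  finally show ?case by (simp only: weight_word)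
qed (simp add: weight_word)

text \<open>Each pulse is met once per period. Hence a list of odd length cannot cancel
  completely.\<close>

lemma sum_pulses:
  assumes "K > 0"
  shows "(\<Sum>i<K. pulses K ps (int i)) = of_nat (length ps)"
proof (induction ps)
  case (Cons p ps)
  have "{..<K} \<inter> {i. [p = int i] (mod int K)} = {nat (p mod int K)}"
    using assms by (auto simp: cong_def nat_less_iff)
  then have "(\<Sum>i<K. pulse K p (int i)) = 1"
    by (simp add: pulse_def sum.If_cases of_bool_def)
  then show ?case using Cons by (simp add: sum.distrib)
qed simp

section \<open>Triples of inputs and their parities\<close>

fun triple_inputs :: "int list \<Rightarrow> int list" where
  "triple_inputs [] = []"
| "triple_inputs (c # cs) = c # (c + 1) # (c + 5) # triple_inputs cs"

fun triple_parities :: "int list \<Rightarrow> int list" where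
  "triple_parities [] = []"
| "triple_parities (c # cs) = c # (c + 4) # (c + 5) # triple_parities cs"

text \<open>Over the two-element field \<open>1 + D + D^5 = (1 + D + D^2)(1 + D^2 + D^3)\<close> and
  \<open>1 + D^4 + D^5 = (1 + D + D^2)(1 + D + D^3)\<close>.\<close>

lemma tailbiting_pair_triples:
  assumes "K > 0"
  shows "tailbiting_pair K (word K (pulses K (triple_inputs cs))) (word K (pulses K (triple_parities cs)))"
proof -
  \<comment> \<open>The register content is the common cofactor 1 + D + D^2 applied to the starting
    points.\<close>
  define S where "S = concat (map (\<lambda>c. [c, c + 1, c + 2]) cs)"
  have "pulses K (triple_inputs cs) t = pulses K S t + pulses K S (t - 2) + pulses K S (t - 3)" for t
    unfolding S_def pulses_shift
    by (induction cs) (simp_all add: add_ac)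
  moreover have "pulses K (triple_parities cs) t = pulses K S t + pulses K S (t - 1) + pulses K S (t - 3)" for t
    unfolding S_def pulses_shift
    by (induction cs) (simp_all add: add_ac)
  moreover have "cyc_nth (word K (pulses K S)) t = pulses K S t" for t
    by (rule cyc_nth_word[OF assms pulses_cong_arg])
  ultimately show ?thesis
    unfolding tailbiting_pair_def by (intro conjI exI[of _ "word K (pulses K S)"]) simp_all
qed

text \<open>For \<open>c\<close> in class 1 the last two cases are, as vectors (P1, P2, P3), the
  relations (1 + z, 1 + z^2, 0) and (1, 0, 1 + z^2); a single triple starting in class 2 is (0, 1, 1
  + z). These are the Koszul relations of (1 + z^2, 1 + z, 1), of which the cross products below are
  combinations.\<close>

lemma pulses_triple_inputs:
  "pulses K (triple_inputs (c # cs)) t = pulses K [c, c + 1, c + 5] t + pulses K (triple_inputs cs) t"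
  "pulses K (triple_inputs (c # (c + 4) # cs)) t =
     pulses K [c, c + 1, c + 4, c + 9] t + pulses K (triple_inputs cs) t"
  "pulses K (triple_inputs (c # (c + 1) # (c + 5) # cs)) t =
     pulses K [c, c + 2, c + 10] t + pulses K (triple_inputs cs) t"
  by (simp_all add: add_ac)

text \<open>The sizes 3, 4 and 7 account for the parity weights 24 = 4 + 2 * 7 + 2 * 3 and 25 = 2 *
  4 + 2 * 7 + 3.\<close>

lemma pulses_triple_parities:
  "pulses K (triple_parities (c # cs)) t = pulses K [c, c + 4, c + 5] t + pulses K (triple_parities cs) t"
  "pulses K (triple_parities (c # (c + 4) # cs)) t =
     pulses K [c, c + 5, c + 8, c + 9] t + pulses K (triple_parities cs) t"
  "pulses K (triple_parities (c # (c + 1) # (c + 5) # cs)) t =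
     pulses K [c, c + 1, c + 4, c + 5, c + 6, c + 9, c + 10] t + pulses K (triple_parities cs) t"
  by (simp_all add: add_ac)

lemmas pulses_triples = pulses_triple_inputs(2,3) pulses_triple_parities(2,3)
  triple_inputs.simps(1) triple_parities.simps(1) pulses_simps(1,2) bit_add_ac add.left_neutral add.right_neutral

lemma residue_1_add:
  assumes "c mod 4 = (1 :: int)"
  shows "(c + 1) mod 4 = 2" "(c + 2) mod 4 = 3" "(c + 4) mod 4 = 1" "(c + 5) mod 4 = 2"
    "(c + 9) mod 4 = 2" "(c + 10) mod 4 = 3"
  using assms by presburger+

lemma residue_2_add:
  assumes "c mod 4 = (2 :: int)"
  shows "(c + 1) mod 4 = 3" "(c + 5) mod 4 = 3"
  using assms by presburger+

lemma pulses_triple_parities_eq_0: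
  assumes "4 dvd K" "4 dvd t" "\<And>c. c \<in> set cs \<Longrightarrow> c mod 4 = 1 \<or> c mod 4 = 2"
  shows "pulses K (triple_parities cs) t = 0"
proof -
  have ne: "pulse K p t = 0" if "p mod 4 \<noteq> 0" for p
    using assms(1,2) that by (intro pulse_eq_0) auto
  show ?thesis using assms(3)
  proof (induction cs)
    case (Cons c cs)
    then have "c mod 4 = 1 \<or> c mod 4 = 2" by simp
    then have "c mod 4 \<noteq> 0" "(c + 4) mod 4 \<noteq> 0" "(c + 5) mod 4 \<noteq> 0" by presburger+
    then show ?case using Cons ne by simp
  qed simp
qed

section \<open>Quadratic permutation polynomials\<close>

definition quad_poly :: "int \<Rightarrow> int \<Rightarrow> int \<Rightarrow> int" where
  "quad_poly a b x = a * x + b * x\<^sup>2"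

lemma quad_poly_diff: "quad_poly a b x - quad_poly a b y = (x - y) * (a + b * (x + y))"
  by (simp add: quad_poly_def power2_eq_square algebra_simps)

lemma quad_poly_cong: "[x = y] (mod m) \<Longrightarrow> [quad_poly a b x = quad_poly a b y] (mod m)"
  unfolding quad_poly_def by (intro cong_add cong_mult cong_pow cong_refl)

lemma int_quad_map: "[int (quad_map K f1 f2 n) = quad_poly (int f1) (int f2) (int n)] (mod int K)"
  by (simp add: quad_map_def quad_poly_def cong_def zmod_int)

text \<open>The permutation property on integers up to congruence, so that shifts and negative
  arguments need no reduction to representatives.\<close>

locale quad_perm =
  fixes K :: nat and a b :: int
  assumes K_pos: "K > 0"
    and inj: "[quad_poly a b x = quad_poly a b y] (mod int K) \<Longrightarrow> [x = y] (mod int K)"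
    and surj: "\<exists>x. [quad_poly a b x = y] (mod int K)"

lemma quad_perm_of_QPP:
  assumes "is_QPP K f1 f2"
  shows "quad_perm K (int f1) (int f2)"
proof
  have bij: "bij_betw (quad_map K f1 f2) {..<K} {..<K}" and K: "K \<ge> 2"
    using assms by (auto simp: is_QPP_def)
  then show "K > 0" by simp
  define r where "r x = nat (x mod int K)" for x
  have r: "r x < K" "[int (r x) = x] (mod int K)" for x
    using K by (auto simp: r_def nat_less_iff cong_def)
  have qr: "[int (quad_map K f1 f2 (r x)) = quad_poly (int f1) (int f2) x] (mod int K)" for x
    using int_quad_map quad_poly_cong[OF r(2)] cong_trans by blast
  {
    fix x y
    assume "[quad_poly (int f1) (int f2) x = quad_poly (int f1) (int f2) y] (mod int K)"
    then have "[int (quad_map K f1 f2 (r x)) = int (quad_map K f1 f2 (r y))] (mod int K)"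
      using qr[of x] qr[of y] by (simp add: cong_def)
    then have "quad_map K f1 f2 (r x) = quad_map K f1 f2 (r y)"
      using K by (simp add: cong_int_iff cong_def quad_map_def)
    then have "r x = r y"
      using bij r(1) unfolding bij_betw_def by (meson inj_onD lessThan_iff)
    then show "[x = y] (mod int K)" using r(2)[of x] r(2)[of y] by (simp add: cong_def)
  }
  fix y
  have "r y \<in> quad_map K f1 f2 ` {..<K}"
    using bij r(1)[of y] by (simp add: bij_betw_def)
  then obtain n where "quad_map K f1 f2 n = r y" by auto
  then have "[quad_poly (int f1) (int f2) (int n) = y] (mod int K)"
    using int_quad_map[of K f1 f2 n] r(2)[of y] by (simp add: cong_def)
  then show "\<exists>x. [quad_poly (int f1) (int f2) x = y] (mod int K)" by blast
qed

section \<open>Divisibility forced on the coefficients\<close>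

context quad_perm
begin

text \<open>Otherwise \<open>k\<close> and 0 would have the same value modulo
  \<open>K\<close>.\<close>

lemma prime_not_dvd_linear_coeff:
  assumes p: "prime p" "int K = p * k" "p dvd b * k"
  shows "\<not> p dvd a"
proof
  assume "p dvd a"
  have "quad_poly a b k - quad_poly a b 0 = a * k + (b * k) * k"
    by (simp add: quad_poly_def power2_eq_square)
  moreover have "int K dvd a * k + (b * k) * k"
    using \<open>p dvd a\<close> p(2,3) by (simp add: mult_dvd_mono)
  ultimately have "int K dvd k - 0"
    using inj[of k 0] by (simp add: cong_iff_dvd_diff)
  moreover have "0 < k" using p(2) K_pos prime_gt_0_int[OF p(1)]
    by (metis of_nat_0_less_iff zero_less_mult_pos)
  ultimately have "p * k \<le> k" using p(2) zdvd_imp_le by simp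
  then show False using prime_gt_1_int[OF p(1)] \<open>0 < k\<close> by simp
qed

text \<open>The values at \<open>k * i\<close> and \<open>k * j\<close> agree as soon as
  \<open>p\<close> divides \<open>a + b * (k * (i + j))\<close>. If \<open>p\<close> does not divide
  \<open>b\<close>, this can be solved with \<open>i\<close> and \<open>j\<close> distinct modulo
  \<open>p\<close>.\<close>

lemma odd_prime_dvd_quadratic_coeff:
  assumes p: "prime p" "odd p" "int K = p * k" "\<not> p dvd k"
  shows "p dvd b"
proof (rule ccontr)
  assume "\<not> p dvd b"
  then have "coprime (b * k) p"
    using p by (metis coprime_commute prime_dvd_mult_iff prime_imp_coprime)
  then obtain c where c: "[(b * k) * c = 1] (mod p)" using cong_solve_coprime_int by blast
  define s where "s = - a * c"
  have "a + b * (k * s) = a * (1 - (b * k) * c)" by (simp add: s_def algebra_simps)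
  then have s: "p dvd a + b * (k * s)" using c by (simp add: cong_iff_dvd_diff dvd_diff_commute)
  \<comment> \<open>The sum \<open>s\<close> is split as \<open>s + 0\<close>, or as
    \<open>1 + (-1)\<close> when it is 0 modulo \<open>p\<close>; 1 and -1 are distinct because
    \<open>p\<close> is odd.\<close>
  have "\<exists>i j. p dvd a + b * (k * (i + j)) \<and> \<not> p dvd i - j"
  proof (cases "p dvd s")
    case False
    then show ?thesis using s by (intro exI[of _ s] exI[of _ 0]) auto
  next
    case True
    then have "p dvd a" using s by (metis dvd_add_left_iff dvd_mult)
    moreover have "\<not> p dvd 2"
      using p(1,2) by (metis primes_dvd_imp_eq two_is_prime_nat prime_int_numeral_eq dvd_refl)
    ultimately show ?thesis by (intro exI[of _ 1] exI[of _ "-1"]) auto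
  qed
  then obtain i j where ij: "p dvd a + b * (k * (i + j))" "\<not> p dvd i - j" by blast
  have "quad_poly a b (k * i) - quad_poly a b (k * j) = k * (a + b * (k * (i + j))) * (i - j)"
    by (simp add: quad_poly_diff algebra_simps)
  moreover have "int K dvd k * (a + b * (k * (i + j)))"
    unfolding p(3) using ij(1) by (simp add: mult.commute[of p])
  ultimately have "int K dvd k * i - k * j"
    using inj[of "k * i" "k * j"] by (simp add: cong_iff_dvd_diff)
  then have "k * p dvd k * (i - j)" by (simp add: p(3) algebra_simps)
  moreover have "k \<noteq> 0" using p(3) K_pos by auto
  ultimately show False using ij(2) by simp
qed

end

text \<open>Third differences of the composition show that \<open>2 ^ n\<close> divides \<open>4 * d * b\<close>; together with
  the quadratic terms this eliminates the coefficients of the inverse.\<close>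

lemma quadratic_inverse_two_power_dvd:
  fixes a b c d :: int
  assumes inverse: "\<And>x. [quad_poly c d (quad_poly a b x) = x] (mod 2 ^ n)"
    and parity: "odd a" "even b" "odd c"
  shows "2 ^ n dvd 4 * b\<^sup>2"
proof -
  define h where "h x = quad_poly c d (quad_poly a b x) - x" for x
  have h: "2 ^ n dvd h x" for x using inverse by (simp add: h_def cong_iff_dvd_diff)
  \<comment> \<open>The third forward difference at 0; the missing term \<open>h 0\<close> is
    zero.\<close>
  have "h 3 - 3 * h 2 + 3 * h 1 = 3 * (a + 3 * b) * (4 * (d * b))"
    by (simp add: h_def quad_poly_def power2_eq_square algebra_simps)
  then have "2 ^ n dvd (3 * (a + 3 * b)) * (4 * (d * b))"
    using h by (metis dvd_add dvd_diff dvd_mult)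
  moreover have "coprime (2 ^ n) (3 * (a + 3 * b))" using parity by simp
  ultimately have 1: "2 ^ n dvd 4 * (d * b)" by (metis coprime_dvd_mult_right_iff)
  \<comment> \<open>The symmetric sum isolates the terms of even degree. Multiplying it by
    \<open>2 * b\<close> makes \<open>d\<close> occur only in the product
    \<open>d * b\<close>.\<close>
  have "h 1 + h (-1) = 2 * (c * b + d * a\<^sup>2 + d * b\<^sup>2)"
    by (simp add: h_def quad_poly_def power2_eq_square algebra_simps)
  then have "2 ^ n dvd 2 * b * (2 * (c * b + d * a\<^sup>2 + d * b\<^sup>2))"
    using h by (metis dvd_add dvd_mult)
  moreover have "2 * b * (2 * (c * b + d * a\<^sup>2 + d * b\<^sup>2)) =
      c * (4 * b\<^sup>2) + (4 * (d * b)) * (a\<^sup>2 + b\<^sup>2)"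
    by (simp add: power2_eq_square algebra_simps)
  ultimately have "2 ^ n dvd c * (4 * b\<^sup>2)"
    using 1 by (metis dvd_add_left_iff dvd_mult2)
  moreover have "coprime (2 ^ n) c" using parity by simp
  ultimately show ?thesis by (metis coprime_dvd_mult_right_iff)
qed

text \<open>The cross term of \<open>quad_poly a b (x + y)\<close> is \<open>2 * b * x * y\<close>.
  By \<open>K_dvd_16b\<close> it vanishes modulo \<open>K\<close> when 8 divides
  \<open>x * y\<close>; \<open>K_dvd_8b\<close> serves the shift \<open>\<rho>\<close> below, which
  is a priori only a multiple of 4.\<close>

locale good_quad_perm = quad_perm +
  assumes four_dvd_K: "4 dvd int K"
    and odd_a: "odd a" and even_b: "even b"
    and K_dvd_16b: "int K dvd 16 * b"
    and K_dvd_8b: "int K dvd 8 * b \<or> 4 dvd b \<and> 8 dvd int K"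
    and a_inverse: "\<exists>m. [a * m = 1] (mod int K)"

lemma good_quad_perm_of_QPP:
  assumes "4 dvd K" and m2: "multiplicity 2 K \<le> 7"
    and mp: "\<forall>p. prime p \<and> p \<noteq> 2 \<longrightarrow> multiplicity p K \<le> 1"
    and qpp: "is_QPP K f1 f2" and inv: "has_quadratic_inverse K f1 f2"
  shows "good_quad_perm K (int f1) (int f2)"
proof -
  interpret quad_perm K "int f1" "int f2" by (rule quad_perm_of_QPP[OF qpp])
  obtain g1 g2 where gq: "is_QPP K g1 g2"
    and g: "\<And>x. x < K \<Longrightarrow> quad_map K g1 g2 (quad_map K f1 f2 x) = x"
    using inv by (auto simp: has_quadratic_inverse_def)
  interpret G: quad_perm K "int g1" "int g2" by (rule quad_perm_of_QPP[OF gq])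
  obtain k where k: "K = 4 * k" using \<open>4 dvd K\<close> by blast
  have odd: "odd (int f1)"
    using prime_not_dvd_linear_coeff[of 2 "2 * int k"] k by simp
  have oddg: "odd (int g1)"
    using G.prime_not_dvd_linear_coeff[of 2 "2 * int k"] k by simp
  have even: "even (int f2)"
  proof (rule ccontr)
    assume "odd (int f2)"
    obtain x where "[quad_poly (int f1) (int f2) x = 1] (mod int K)" using surj by blast
    then have "[quad_poly (int f1) (int f2) x = 1] (mod 2)"
      by (rule cong_dvd_modulus) (simp add: k)
    moreover have "even (quad_poly (int f1) (int f2) x)"
      using odd \<open>odd (int f2)\<close> by (simp add: quad_poly_def)
    ultimately show False by (simp add: cong_def even_iff_mod_2_eq_zero)
  qed
  have inverse: "[quad_poly (int g1) (int g2) (quad_poly (int f1) (int f2) x) = x] (mod int K)" for x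
  proof -
    define n where "n = nat (x mod int K)"
    have n: "n < K" "[int n = x] (mod int K)"
      using K_pos by (auto simp: n_def nat_less_iff cong_def)
    have "[int (quad_map K f1 f2 n) = quad_poly (int f1) (int f2) x] (mod int K)"
      by (rule cong_trans[OF int_quad_map quad_poly_cong[OF n(2)]])
    then have "[quad_poly (int g1) (int g2) (int (quad_map K f1 f2 n)) =
        quad_poly (int g1) (int g2) (quad_poly (int f1) (int f2) x)] (mod int K)"
      by (rule quad_poly_cong)
    moreover have "[int n = quad_poly (int g1) (int g2) (int (quad_map K f1 f2 n))] (mod int K)"
      using int_quad_map[of K g1 g2 "quad_map K f1 f2 n"] g[OF n(1)] by simp
    ultimately show ?thesis using n(2) by (simp add: cong_def)
  qed
  define n where "n = multiplicity 2 K"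
  have "2 ^ n dvd K" by (simp add: n_def multiplicity_dvd)
  then have "(2 :: int) ^ n dvd int K" by (metis of_nat_dvd_iff of_nat_numeral of_nat_power)
  then have "2 ^ n dvd 4 * (int f2)\<^sup>2"
    using quadratic_inverse_two_power_dvd[OF cong_dvd_modulus[OF inverse] odd even oddg] by blast
  then have two: "2 ^ n dvd 4 * f2\<^sup>2"
    by (metis (mono_tags, lifting) of_nat_dvd_iff of_nat_mult of_nat_numeral of_nat_power)
  have oddp: "p dvd f2" if p: "prime p" "p \<noteq> 2" "p dvd K" for p
  proof -
    from p(3) obtain j where j: "K = p * j" by blast
    have "\<not> p ^ 2 dvd K"
      using mp p K_pos prime_gt_1_nat[OF p(1)]
      by (subst power_dvd_iff_le_multiplicity) (auto simp: not_le less_Suc_eq_le)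
    then have "\<not> p dvd j" using j by (auto simp: power2_eq_square)
    then have "int p dvd int f2"
      using odd_prime_dvd_quadratic_coeff[of "int p" "int j"] p j primes_dvd_imp_eq[of 2 p] by auto
    then show ?thesis by simp
  qed
  \<comment> \<open>\<open>f2 = 0\<close> is set apart because multiplicities in 0 are 0 by
    convention. For odd primes \<open>oddp\<close> suffices, as they divide \<open>K\<close> at most
    once.\<close>
  have nat16: "K dvd 2 ^ e * f2" if "f2 \<noteq> 0" "n \<le> e + multiplicity 2 f2" for e
  proof (rule multiplicity_le_imp_dvd)
    fix p :: nat assume p: "prime p"
    show "multiplicity p K \<le> multiplicity p (2 ^ e * f2)"
    proof (cases "p = 2")
      case True
      then show ?thesis using that
        by (simp add: n_def prime_elem_multiplicity_mult_distrib)
    next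
      case False
      show ?thesis
      proof (cases "p dvd K")
        case True
        then have "p dvd 2 ^ e * f2" using oddp p False by simp
        then have "1 \<le> multiplicity p (2 ^ e * f2)"
          using that(1) p prime_gt_1_nat[OF p] by (intro multiplicity_geI) auto
        then show ?thesis using mp p False le_trans by blast
      qed (simp add: not_dvd_imp_multiplicity_0)
    qed
  qed (use K_pos in simp)
  have v: "n \<le> 2 + 2 * multiplicity 2 f2" if "f2 \<noteq> 0"
  proof -
    have "n \<le> multiplicity 2 (4 * f2\<^sup>2)"
      using two that by (intro multiplicity_geI) auto
    also have "4 * f2\<^sup>2 = (2 * f2)\<^sup>2" by (simp add: power_mult_distrib)
    also have "multiplicity 2 \<dots> = 2 + 2 * multiplicity 2 f2"
      using that
      by (subst prime_elem_multiplicity_power_distrib) (simp_all add: prime_elem_multiplicity_mult_distrib)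
    finally show ?thesis .
  qed
  have v1: "1 \<le> multiplicity 2 f2" if "f2 \<noteq> 0"
    using even that by (intro multiplicity_geI) auto
  have "K dvd 16 * f2"
  proof (cases "f2 = 0")
    case False
    \<comment> \<open>The bound 7 enters here. Let r be the exponent of 2 in \<open>f2\<close>: if r
      \<le> 2, then 2 + 2 * r \<le> 4 + r, and if r \<ge> 3, then 7 \<le> 4 + r.\<close>
    then have "n \<le> 4 + multiplicity 2 f2" using v v1 m2 n_def by linarith
    then show ?thesis using nat16[of 4] False by simp
  qed simp
  then have d16: "int K dvd 16 * int f2" by (metis of_nat_dvd_iff of_nat_mult of_nat_numeral)
  have "K dvd 8 * f2 \<or> 4 dvd f2 \<and> 8 dvd K"
  proof (cases "f2 = 0 \<or> n \<le> 3 + multiplicity 2 f2")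
    case True
    then show ?thesis using nat16[of 3] by (cases "f2 = 0") auto
  next
    case False
    then have "2 \<le> multiplicity 2 f2" "3 \<le> n" using v v1 by auto
    then have "2 ^ 2 dvd f2" by (intro multiplicity_dvd')
    moreover have "2 ^ 3 dvd K" using \<open>3 \<le> n\<close> unfolding n_def by (rule multiplicity_dvd')
    ultimately show ?thesis by simp
  qed
  then have d8: "int K dvd 8 * int f2 \<or> 4 dvd int f2 \<and> 8 dvd int K"
    by (metis of_nat_dvd_iff of_nat_mult of_nat_numeral)
  \<comment> \<open>Every prime dividing \<open>K\<close> divides \<open>f2\<close>, so the
    collision argument keeps it from dividing \<open>f1\<close>.\<close>
  have "coprime (int f1) (int K)"
  proof (rule ccontr)
    assume "\<not> coprime (int f1) (int K)"
    then have "\<not> coprime f1 K" by simp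
    then obtain p where p: "prime p" "p dvd f1" "p dvd K"
      by (metis coprime_iff_gcd_eq_1 gcd_greatest prime_factor_nat dvd_trans gcd_dvd1 gcd_dvd2)
    obtain j where j: "K = p * j" using p(3) by blast
    have "p dvd f2" using oddp[OF p(1) _ p(3)] even by (cases "p = 2") auto
    then show False
      using prime_not_dvd_linear_coeff[of "int p" "int j"] p j by simp
  qed
  then have "\<exists>m. [int f1 * m = 1] (mod int K)" using cong_solve_coprime_int by blast
  then show ?thesis
    using odd even d16 d8 k by unfold_locales auto
qed

section \<open>Sums of triples before and after interleaving\<close>

text \<open>\<open>us\<close> lists the input positions; \<open>cs\<close> and \<open>ds\<close> are the starting points of the triples in the
  upper and in the lower encoder.\<close>

definition light_word :: "nat \<Rightarrow> int \<Rightarrow> int \<Rightarrow> nat \<Rightarrow> bool" where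
  "light_word K a b w \<longleftrightarrow> (\<exists>us cs ds ya yb.
     (\<forall>c \<in> set cs \<union> set ds. c mod 4 = 1 \<or> c mod 4 = 2) \<and>
     (\<forall>t. pulses K us t = pulses K (triple_inputs cs) t) \<and>
     (\<forall>t. pulses K (map (quad_poly a b) us) t = pulses K (triple_inputs ds) t) \<and>
     (\<forall>t. pulses K ya t = pulses K (triple_parities cs) t) \<and>
     (\<forall>t. pulses K yb t = pulses K (triple_parities ds) t) \<and>
     (\<exists>t. pulses K us t \<noteq> 0) \<and>
     length us + length ya + length yb \<le> w)"

lemma light_wordI:
  assumes "\<And>c. c \<in> set cs \<union> set ds \<Longrightarrow> c mod 4 = 1 \<or> c mod 4 = 2"
    and "\<And>t. pulses K us t = pulses K (triple_inputs cs) t"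
    and "\<And>t. pulses K (map (quad_poly a b) us) t = pulses K (triple_inputs ds) t"
    and "\<And>t. pulses K ya t = pulses K (triple_parities cs) t"
    and "\<And>t. pulses K yb t = pulses K (triple_parities ds) t"
    and "pulses K us z \<noteq> 0"
    and "length us + length ya + length yb \<le> w"
  shows "light_word K a b w"
  unfolding light_word_def using assms by blast

section \<open>Positions under the interleaver\<close>

context quad_perm
begin

abbreviation F :: "int \<Rightarrow> int" where "F \<equiv> quad_poly a b"

lemma pulses_map_F: "[F x = t] (mod int K) \<Longrightarrow> pulses K (map F ps) t = pulses K ps x"
proof (induction ps)
  case (Cons p ps)
  have "[F p = t] (mod int K) \<longleftrightarrow> [p = x] (mod int K)"
    using inj quad_poly_cong Cons.prems by (meson cong_sym cong_trans)
  then show ?case using Cons by (simp add: pulse_def)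
qed simp

text \<open>Carries identities that hold only after cancellation through the interleaver; the two
  lists need not match entry by entry.\<close>

lemma pulses_map_F_eq:
  assumes "\<And>t. pulses K ps t = pulses K ps' t"
  shows "pulses K (map F ps) t = pulses K (map F ps') t"
proof -
  obtain x where "[F x = t] (mod int K)" using surj by blast
  then show ?thesis using assms[of x] by (simp only: pulses_map_F)
qed

text \<open>The defect is the cross term. Relations between images are translated in this way
  below.\<close>

lemma F_shift_cong:
  assumes "[F x = F y + c] (mod int K)" "int K dvd 2 * b * (d * (x - y))"
  shows "[F (x + d) = F (y + d) + c] (mod int K)"
proof -
  have "F (x + d) - (F (y + d) + c) = (F x - (F y + c)) + 2 * b * (d * (x - y))"
    by (simp add: quad_poly_def power2_eq_square algebra_simps)
  then show ?thesis using assms unfolding cong_iff_dvd_diff by (metis dvd_add)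
qed

end

section \<open>Residue classes, and shifts by 4 and 8\<close>

context good_quad_perm
begin

lemma K_dvd_2b: "8 dvd s \<Longrightarrow> int K dvd 2 * b * s"
  using K_dvd_16b by (auto simp: dvd_def algebra_simps)

text \<open>Both \<open>b\<close> and \<open>x\<^sup>2 - x\<close> are even, so \<open>F x\<close>
  is \<open>(a + b) * x\<close> modulo 4.\<close>

lemma F_mod_4_id:
  assumes "(a + b) mod 4 = 1"
  shows "F x mod 4 = x mod 4"
proof -
  obtain b' where b': "b = 2 * b'" using even_b by blast
  obtain c where c: "x\<^sup>2 - x = 2 * c"
    using evenE[of "x\<^sup>2 - x"] by auto
  obtain k where k: "a = 4 * k + 1 - b"
    using assms mult_div_mod_eq[of 4 "a + b"] by (metis add_diff_cancel_right')
  have "F x - x = 4 * k * x + b * (x\<^sup>2 - x)"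
    unfolding k by (simp add: quad_poly_def algebra_simps)
  also have "\<dots> = 4 * (k * x + b' * c)" by (simp only: b' c) (simp add: algebra_simps)
  finally show ?thesis by (metis dvd_triv_left mod_eq_dvd_iff)
qed

lemma F_mod_4_swap:
  assumes "(a + b) mod 4 = 3"
  shows "F x mod 4 = (- x) mod 4"
proof -
  obtain b' where b': "b = 2 * b'" using even_b by blast
  obtain c where c: "x\<^sup>2 - x = 2 * c"
    using evenE[of "x\<^sup>2 - x"] by auto
  obtain k where k: "a = 4 * k + 3 - b"
    using assms mult_div_mod_eq[of 4 "a + b"] by (metis add_diff_cancel_right')
  have "F x - (- x) = 4 * (k + 1) * x + b * (x\<^sup>2 - x)"
    unfolding k by (simp add: quad_poly_def algebra_simps)
  also have "\<dots> = 4 * ((k + 1) * x + b' * c)" by (simp only: b' c) (simp add: algebra_simps)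
  finally show ?thesis by (metis dvd_triv_left mod_eq_dvd_iff)
qed

text \<open>\<open>j\<close> is the inverse \<open>m\<close> of \<open>a\<close> after one Newton
  correction; the remainder is a multiple of \<open>16 * b\<close>. The shift depends on
  \<open>x\<close>.\<close>

lemma ex_shift_4:
  obtains w where "4 dvd w" "[F (x + w) = F x + 4] (mod int K)"
proof -
  obtain m where m: "int K dvd a * m - 1" using a_inverse by (auto simp: cong_iff_dvd_diff)
  define j where "j = m - 2 * b * m\<^sup>2 * x"
  have "F (x + 4 * j) - (F x + 4) = (a * m - 1) * (4 - 8 * b * m * x)
      + 16 * b * (j\<^sup>2 - b * m\<^sup>2 * x\<^sup>2)"
    by (simp add: quad_poly_def j_def power2_eq_square algebra_simps)
  also have "int K dvd \<dots>" by (rule dvd_add[OF dvd_mult2[OF m] dvd_mult2[OF K_dvd_16b]])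
  finally show ?thesis using that[of "4 * j"] by (simp add: cong_iff_dvd_diff)
qed

text \<open>The cross term is now a multiple of \<open>16 * b\<close>, so one shift serves all
  \<open>x\<close>. It plays the part of w^2, where w is the shift inducing 4.\<close>

lemma ex_shift_8:
  obtains v where "8 dvd v" "\<And>x. [F (x + v) = F x + 8] (mod int K)"
proof -
  obtain m where m: "int K dvd a * m - 1" using a_inverse by (auto simp: cong_iff_dvd_diff)
  have "[F (x + 8 * m) = F x + 8] (mod int K)" for x
  proof -
    have "F (x + 8 * m) - (F x + 8) = (a * m - 1) * 8 + 16 * b * (m * x + 4 * m\<^sup>2)"
      by (simp add: quad_poly_def power2_eq_square algebra_simps)
    also have "int K dvd \<dots>" by (rule dvd_add[OF dvd_mult2[OF m] dvd_mult2[OF K_dvd_16b]])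
    finally show ?thesis by (simp add: cong_iff_dvd_diff)
  qed
  then show ?thesis using that[of "8 * m"] by simp
qed

text \<open>If \<open>8 * b\<close> is nonzero modulo \<open>K\<close>, shifting by 4 acts differently on even and on odd
  positions; the blocks below still match because \<open>x1 - x3 + 2\<close> is then divisible by 8.\<close>

lemma K_dvd_2b_rho:
  assumes "x1 mod 4 = 1" "x3 mod 4 = 3"
    and "[F x1 = i] (mod int K)" "[F x3 = j] (mod int K)"
    and "(a + b) mod 4 = 1 \<and> i = 1 \<and> j = 3 \<or> (a + b) mod 4 = 3 \<and> i = 3 \<and> j = 1"
  shows "int K dvd 2 * b * (x1 - x3 + 2)"
  using K_dvd_8b
proof
  assume K: "int K dvd 8 * b"
  have "4 dvd x1 - x3 + 2" using assms(1,2) by presburger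
  then obtain k where "x1 - x3 + 2 = 4 * k" by blast
  then have "2 * b * (x1 - x3 + 2) = 8 * b * k" by (simp only: ac_simps)
  then show ?thesis using K by (metis dvd_mult2)
next
  assume *: "4 dvd b \<and> 8 dvd int K"
  obtain c d where c: "x1 = 4 * c + 1" and d: "x3 = 4 * d + 3"
    using assms(1,2) by (metis mult_div_mod_eq)
  obtain b' where b': "b = 4 * b'" using * by blast
  have "[F x1 - F x3 = i - j] (mod 8)"
    using assms(3,4) * by (meson cong_diff cong_dvd_modulus)
  then have F8: "8 dvd F x1 - F x3 - (i - j)" by (simp add: cong_iff_dvd_diff)
  have "8 dvd x1 - x3 + 2"
    using assms(5)
  proof (elim disjE conjE)
    assume ab: "(a + b) mod 4 = 1" "i = 1" "j = 3"
    then have "a mod 4 = 1" using b' by simp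
    then obtain e where e: "a = 4 * e + 1" by (metis mult_div_mod_eq)
    \<comment> \<open>As 4 divides both \<open>b\<close> and \<open>x1 + x3\<close>, the quadratic
      part drops out modulo 8. Since \<open>x1 - x3\<close> is even, multiplication by
      \<open>a\<close> fixes it modulo 8 here and negates it in the other case.\<close>
    have "F x1 - F x3 - (i - j) =
        (x1 - x3 + 2) + 8 * ((2 * (c - d) - 1) * (e + 4 * b' * (c + d + 1)))"
      unfolding quad_poly_diff ab c d e b' by (simp add: algebra_simps)
    then show ?thesis using F8 by (metis dvd_add_left_iff dvd_triv_left)
  next
    assume ab: "(a + b) mod 4 = 3" "i = 3" "j = 1"
    then have "a mod 4 = 3" using b' by simp
    then obtain e where e: "a = 4 * e + 3" by (metis mult_div_mod_eq)
    have "F x1 - F x3 - (i - j) =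
        8 * ((2 * (c - d) - 1) * (e + 1 + 4 * b' * (c + d + 1))) - (x1 - x3 + 2)"
      unfolding quad_poly_diff ab c d e b' by (simp add: algebra_simps)
    then have "x1 - x3 + 2 =
        8 * ((2 * (c - d) - 1) * (e + 1 + 4 * b' * (c + d + 1))) - (F x1 - F x3 - (i - j))"
      by simp
    then show ?thesis using F8 by (metis dvd_diff dvd_triv_left)
  qed
  then show ?thesis by (rule K_dvd_2b)
qed

lemma K_dvd_2b_mult: "4 dvd s \<Longrightarrow> even t \<Longrightarrow> int K dvd 2 * b * (s * t)"
  using mult_dvd_mono[of 4 s 2 t] by (intro K_dvd_2b) simp

section \<open>The two cross products\<close>

lemma light_word_id:
  assumes ab: "(a + b) mod 4 = 1"
  shows "light_word K a b 67"
proof -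
  \<comment> \<open>Relative to these base points the lower coefficient vector is exactly (1 + w^2,
    1 + w, 1).\<close>
  obtain x1 where x1: "[F x1 = 1] (mod int K)" using surj by blast
  obtain x2 where x2: "[F x2 = 2] (mod int K)" using surj by blast
  obtain x3 where x3: "[F x3 = 3] (mod int K)" using surj by blast
  have F4: "F x mod 4 = x mod 4" for x by (rule F_mod_4_id[OF ab])
  have red: "y mod 4 = x mod 4" if "[F x = y] (mod int K)" for x y
    using cong_dvd_modulus[OF that four_dvd_K] F4[of x] by (simp add: cong_def)
  have c: "x1 mod 4 = 1" "x2 mod 4 = 2" "x3 mod 4 = 3"
    using red[OF x1] red[OF x2] red[OF x3] by auto
  \<comment> \<open>These displacements carry \<open>x3\<close> to \<open>x1 + 2\<close> and
    \<open>x2 + 1\<close>. Written multiplicatively, the upper coefficient vector at the same base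
    points is (\<rho>(1 + z^2), \<delta>(1 + z), 1).\<close>
  define \<rho> \<delta> where "\<rho> = x1 - x3 + 2" and "\<delta> = x2 - x3 + 1"
  have "int K dvd 2 * b * \<rho>"
    unfolding \<rho>_def by (rule K_dvd_2b_rho[OF c(1,3) x1 x3]) (use ab in simp)
  then have \<rho>: "int K dvd 2 * b * (\<rho> * s)" for s
    using dvd_mult2[of "int K" "2 * b * \<rho>" s] by (simp only: mult.assoc)
  have \<rho>8: "int K dvd 2 * b * ((\<rho> + 8) * s)" for s
    using dvd_add[OF \<rho>[of s] K_dvd_2b[of "8 * s"]] by (simp only: distrib_left distrib_right dvd_triv_left)
  have d4: "4 dvd \<delta>" "4 dvd \<delta> + 4" using c unfolding \<delta>_def by presburger+
  obtain w where w: "4 dvd w" "[F (x1 + w) = F x1 + 4] (mod int K)" by (rule ex_shift_4)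
  obtain v where v: "8 dvd v" "\<And>x. [F (x + v) = F x + 8] (mod int K)" using ex_shift_8 by blast
  have x32: "[F x3 = F x2 + 1] (mod int K)" and x31: "[F x3 = F x1 + 2] (mod int K)"
    using cong_add[OF x2 cong_refl[of 1]] cong_add[OF x1 cong_refl[of 2]] x3 by (auto simp: cong_def)
  have e31: "even (x3 - x1)" "even (x3 + v - x1)" using c v(1) by presburger+
  \<comment> \<open>\<open>w\<close> was chosen at \<open>x1\<close>; it serves at \<open>x3\<close>
    too, as 4 divides \<open>w\<close> and the points differ by an even number.\<close>
  have "[F (x1 + w + (x3 - x1)) = F (x1 + (x3 - x1)) + 4] (mod int K)"
    using K_dvd_2b_mult[OF w(1) e31(1)] by (intro F_shift_cong[OF w(2)]) (simp add: mult.commute)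
  then have x3w: "[F (x3 + w) = F x2 + 5] (mod int K)"
    using cong_add[OF x32 cong_refl[of 4]] by (simp add: cong_def algebra_simps)
  have x3v: "[F (x3 + v) = F x1 + 10] (mod int K)"
    using cong_add[OF x31 cong_refl[of 8]] v(2)[of x3] by (simp add: cong_def algebra_simps)
  define e where "e = x1 + \<delta>"
  define P where "P = F (e + 1)"
  define Q where "Q = F (e + 9)"
  define R where "R = F e"
  define S where "S = F (e + 4)"
  \<comment> \<open>Known relations are translated by \<open>\<rho>\<close>,
    \<open>\<rho> + 8\<close>, \<open>\<delta>\<close> and \<open>\<delta> + 4\<close>; note that
    \<open>e + 1 = x2 + \<rho>\<close>.\<close>
  have P: "[F (x1 + 2) = P + 1] (mod int K)" "[F (x1 + w + 2) = P + 5] (mod int K)"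
    using F_shift_cong[OF x32 \<rho>] F_shift_cong[OF x3w \<rho>]
    by (simp_all add: P_def e_def \<rho>_def \<delta>_def algebra_simps)
  have Q: "[F (x1 + 10) = Q + 1] (mod int K)" "[F (x1 + w + 10) = Q + 5] (mod int K)"
    using F_shift_cong[OF x32 \<rho>8] F_shift_cong[OF x3w \<rho>8]
    by (simp_all add: Q_def e_def \<rho>_def \<delta>_def algebra_simps)
  have R: "[F (x2 + 1) = R + 2] (mod int K)" "[F (x2 + v + 1) = R + 10] (mod int K)"
    using F_shift_cong[OF x31 K_dvd_2b_mult[OF d4(1) e31(1)]]
      F_shift_cong[OF x3v K_dvd_2b_mult[OF d4(1) e31(2)]]
    by (simp_all add: R_def e_def \<delta>_def algebra_simps)
  have S: "[F (x2 + 5) = S + 2] (mod int K)" "[F (x2 + v + 5) = S + 10] (mod int K)"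
    using F_shift_cong[OF x31 K_dvd_2b_mult[OF d4(2) e31(1)]]
      F_shift_cong[OF x3v K_dvd_2b_mult[OF d4(2) e31(2)]]
    by (simp_all add: S_def e_def \<delta>_def algebra_simps)
  have x15: "[F (x1 + w) = 5] (mod int K)" and x210: "[F (x2 + v) = 10] (mod int K)"
    using cong_add[OF x1 cong_refl[of 4]] cong_add[OF x2 cong_refl[of 8]] w(2) v(2)[of x2]
    by (simp_all add: cong_def)
  have ec: "e mod 4 = 1" using c unfolding e_def \<delta>_def by presburger
  show ?thesis
  \<comment> \<open>These four positions form P2. They are the only ones of the word in class 2, so
    the others cannot cancel them.\<close>
  proof (cases "\<forall>t. pulses K [x2, x2 + v, e + 1, e + 9] t = 0")
    case False
    then obtain t where t: "pulses K [x2, x2 + v, e + 1, e + 9] t \<noteq> 0" by blast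
    have xw: "(x1 + w) mod 4 = 1" using c(1) w(1) by presburger
    have xv: "(x2 + v) mod 4 = 2" using c(2) v(1) by presburger
    have t2: "t mod 4 = 2"
    proof (rule ccontr)
      assume "t mod 4 \<noteq> 2"
      then show False using t by (simp add: pulse_eq_0[OF four_dvd_K] c xv ec residue_1_add)
    qed
    \<comment> \<open>P1 = \<delta>(1 + z) + (1 + w), P2 = \<rho>(1 + z^2) + (1 + w^2), P3 =
      \<rho>(1 + z^2)(1 + w) + \<delta>(1 + z)(1 + w^2). \<open>?vs\<close> lists the images in the
      same order.\<close>
    let ?us = "[e, e + 1, e + 4, e + 9, x1, x1 + 2, x1 + 10, x1 + w, x1 + w + 2, x1 + w + 10,
        x2, x2 + 1, x2 + 5, x2 + v, x2 + v + 1, x2 + v + 5]"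
    let ?vs = "[R, P, S, Q, 1, P + 1, Q + 1, 1 + 4, P + 5, Q + 5,
        1 + 1, R + 2, S + 2, 1 + 9, R + 10, S + 10]"
    show ?thesis
    proof (rule light_wordI[where us = ?us and z = t
          and cs = "[e, e + 4, x1, x1 + 1, x1 + 5, x1 + w, x1 + w + 1, x1 + w + 5, x2, x2 + v]"
          and ds = "[1, 1 + 4, P, Q, R, R + 1, R + 5, S, S + 1, S + 5]"
          and ya = "[e, e + 5, e + 8, e + 9,
            x1, x1 + 1, x1 + 4, x1 + 5, x1 + 6, x1 + 9, x1 + 10,
            x1 + w, x1 + w + 1, x1 + w + 4, x1 + w + 5, x1 + w + 6, x1 + w + 9, x1 + w + 10,
            x2, x2 + 4, x2 + 5, x2 + v, x2 + v + 4, x2 + v + 5]"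
          and yb = "[1, 1 + 5, 1 + 8, 1 + 9, P, P + 4, P + 5, Q, Q + 4, Q + 5,
            R, R + 1, R + 4, R + 5, R + 6, R + 9, R + 10,
            S, S + 1, S + 4, S + 5, S + 6, S + 9, S + 10]"], goal_cases)
      case (1 c')
      have PQRS: "P mod 4 = 2" "Q mod 4 = 2" "R mod 4 = 1" "S mod 4 = 1"
        unfolding P_def Q_def R_def S_def F4 by (simp_all add: ec residue_1_add)
      have "\<forall>c \<in> set [e, e + 4, x1, x1 + 1, x1 + 5, x1 + w, x1 + w + 1, x1 + w + 5, x2, x2 + v]
          \<union> set [1, 1 + 4, P, Q, R, R + 1, R + 5, S, S + 1, S + 5]. c mod 4 = 1 \<or> c mod 4 = 2"
        by (simp add: residue_1_add c ec PQRS xv xw)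
      then show ?case using 1 by (rule bspec)
    next
      case (3 t)
      have "pulses K (map F ?us) t = pulses K ?vs t"
        using P Q R S x1 x2 x15 x210
        by (intro pulses_cong) (simp add: P_def Q_def R_def S_def)
      also have "\<dots> = pulses K (triple_inputs [1, 1 + 4, P, Q, R, R + 1, R + 5, S, S + 1, S + 5]) t"
        by (simp only: pulses_triples pulses_triple_inputs(1)[of _ P] pulses_triple_inputs(1)[of _ Q])
      finally show ?case .
    next
      case 6
      have us: "pulses K ?us t = pulses K [x2, x2 + v, e + 1, e + 9] t"
        by (simp add: pulse_eq_0[OF four_dvd_K] t2 c ec xv xw residue_1_add residue_2_add bit_add_ac)
      show ?case unfolding us by (rule t)
    qed (simp_all only: pulses_triples pulses_triple_inputs(1)[of _ x2] pulses_triple_inputs(1)[of _ "x2 + v"]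
        pulses_triple_parities(1)[of _ x2] pulses_triple_parities(1)[of _ "x2 + v"]
        pulses_triple_parities(1)[of _ P] pulses_triple_parities(1)[of _ Q], simp)
  next
    case True
    \<comment> \<open>P2 = 0 means \<rho>(1 + z^2) = 1 + w^2; the identity is moved from base point
      \<open>x2\<close> to \<open>x3\<close>.\<close>
    have eq: "pulses K [x1 + 2, x1 + 10] t = pulses K [x3, x3 + v] t" for t
    proof -
      have "pulses K [x2, x2 + v] (t - (x3 - x2)) + pulses K [e + 1, e + 9] (t - (x3 - x2)) = 0"
        using True[THEN spec, of "t - (x3 - x2)"]
        by (simp only: pulses_simps(1,2) add.assoc add.left_neutral add.right_neutral)
      then have "pulses K [x2, x2 + v] (t - (x3 - x2)) = pulses K [e + 1, e + 9] (t - (x3 - x2))"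
        by (simp only: bit_add_eq_0_iff)
      then show ?thesis
        unfolding pulses_shift by (simp add: e_def \<delta>_def add.commute)
    qed
    have x311: "[F (x3 + v) = 11] (mod int K)"
      using cong_add[OF x3 cong_refl[of 8]] v(2)[of x3] by (simp add: cong_def)
    have F311: "pulses K (map F [x1 + 2, x1 + 10]) t = pulses K [3, 11] t" for t
    proof -
      have "pulses K (map F [x1 + 2, x1 + 10]) t = pulses K (map F [x3, x3 + v]) t"
        by (rule pulses_map_F_eq) (rule eq)
      also have "\<dots> = pulses K [3, 11] t"
        using x3 x311 by (intro pulses_cong) simp
      finally show ?thesis .
    qed
    show ?thesis
    \<comment> \<open>The solution (1, 0, \<rho>(1 + z^2)), with images 1, 3, 11 after cancellation;
      its weight is 3 + 7 + 7.\<close>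
    proof (rule light_wordI[where us = "[x1, x1 + 2, x1 + 10]" and z = x1
          and cs = "[x1, x1 + 1, x1 + 5]" and ds = "[1, 2, 6]"
          and ya = "[x1, x1 + 1, x1 + 4, x1 + 5, x1 + 6, x1 + 9, x1 + 10]"
          and yb = "[1, 2, 5, 6, 7, 10, 11]"], goal_cases)
      case (1 c')
      have "\<forall>c \<in> set [x1, x1 + 1, x1 + 5] \<union> set [1, 2, 6]. c mod 4 = 1 \<or> c mod 4 = 2"
        by (simp add: residue_1_add c)
      then show ?case using 1 by (rule bspec)
    next
      case (3 t)
      have "pulse K (F x1) t = pulse K 1 t" by (rule pulse_cong[OF x1])
      then show ?case using F311[of t] by (simp add: add_ac)
    next
      case 6
      have "(x1 + 2) mod 4 \<noteq> x1 mod 4" "(x1 + 10) mod 4 \<noteq> x1 mod 4" by presburger+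
      then show ?case by (simp add: pulse_eq_0[OF four_dvd_K]) (simp add: pulse_def)
    qed (simp_all add: add_ac)
  qed
qed

lemma light_word_swap:
  assumes ab: "(a + b) mod 4 = 3"
  shows "light_word K a b 67"
proof -
  \<comment> \<open>\<open>x1\<close> must stay in class 1, so it is the preimage of 3. The lower
    coefficient vector becomes (1, 1 + w, 1 + w^2).\<close>
  obtain x1 where x1: "[F x1 = 3] (mod int K)" using surj by blast
  obtain x2 where x2: "[F x2 = 2] (mod int K)" using surj by blast
  obtain x3 where x3: "[F x3 = 1] (mod int K)" using surj by blast
  have F4: "F x mod 4 = (- x) mod 4" for x by (rule F_mod_4_swap[OF ab])
  have red: "y mod 4 = (- x) mod 4" if "[F x = y] (mod int K)" for x y
    using cong_dvd_modulus[OF that four_dvd_K] F4[of x] by (simp add: cong_def)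
  have c: "x1 mod 4 = 1" "x2 mod 4 = 2" "x3 mod 4 = 3"
  proof -
    show "x1 mod 4 = 1" using red[OF x1] by presburger
    show "x2 mod 4 = 2" using red[OF x2] by presburger
    show "x3 mod 4 = 3" using red[OF x3] by presburger
  qed
  define \<rho> \<delta> where "\<rho> = x1 - x3 + 2" and "\<delta> = x2 - x3 + 1"
  have "int K dvd 2 * b * \<rho>"
    unfolding \<rho>_def by (rule K_dvd_2b_rho[OF c(1,3) x1 x3]) (use ab in simp)
  then have \<rho>: "int K dvd 2 * b * (\<rho> * s)" for s
    using dvd_mult2[of "int K" "2 * b * \<rho>" s] by (simp only: mult.assoc)
  have \<rho>8: "int K dvd 2 * b * ((\<rho> + 8) * s)" for s
    using dvd_add[OF \<rho>[of s] K_dvd_2b[of "8 * s"]] by (simp only: distrib_left distrib_right dvd_triv_left)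
  have d4: "4 dvd \<delta>" "4 dvd \<delta> + 4" using c unfolding \<delta>_def by presburger+
  obtain w where w: "4 dvd w" "[F (x1 + w) = F x1 + 4] (mod int K)" by (rule ex_shift_4)
  have w8: "8 dvd 2 * (x1 + w - x1)" "8 dvd 10 * (x1 + w - x1)" using w(1) by auto
  obtain v where v: "8 dvd v" "\<And>x. [F (x + v) = F x + 8] (mod int K)" using ex_shift_8 by blast
  have x23: "[F x2 = F x3 + 1] (mod int K)" and x13: "[F x1 = F x3 + 2] (mod int K)"
    using cong_add[OF x3 cong_refl[of 1]] cong_add[OF x3 cong_refl[of 2]] x1 x2
    by (auto simp: cong_def)
  have e13: "even (x1 - x3)" "even (x1 + v - x3)" using c v(1) by presburger+
  have x2v: "[F (x2 + v) = F x3 + 9] (mod int K)"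
    using cong_add[OF x23 cong_refl[of 8]] v(2)[of x2] by (simp add: cong_def algebra_simps)
  have x1v: "[F (x1 + v) = F x3 + 10] (mod int K)"
    using cong_add[OF x13 cong_refl[of 8]] v(2)[of x1] by (simp add: cong_def algebra_simps)
  define e where "e = x1 + \<delta>"
  \<comment> \<open>All four are images of points in class 3, so they can start lower triples in
    class 1.\<close>
  define P where "P = F (x1 + 2)"
  define Q where "Q = F (x1 + 10)"
  define R where "R = F (x2 + 1)"
  define S where "S = F (x2 + 5)"
  have P: "[F (e + 1) = P + 1] (mod int K)" "[F (e + v + 1) = P + 9] (mod int K)"
      "[F (x1 + w + 2) = P + 4] (mod int K)"
    using F_shift_cong[OF x23 \<rho>] F_shift_cong[OF x2v \<rho>] F_shift_cong[OF w(2) K_dvd_2b[OF w8(1)]]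
    by (simp_all add: P_def e_def \<rho>_def \<delta>_def algebra_simps)
  have Q: "[F (e + 9) = Q + 1] (mod int K)" "[F (e + v + 9) = Q + 9] (mod int K)"
      "[F (x1 + w + 10) = Q + 4] (mod int K)"
    using F_shift_cong[OF x23 \<rho>8] F_shift_cong[OF x2v \<rho>8] F_shift_cong[OF w(2) K_dvd_2b[OF w8(2)]]
    by (simp_all add: Q_def e_def \<rho>_def \<delta>_def algebra_simps)
  have R: "[F e = R + 2] (mod int K)" "[F (e + v) = R + 10] (mod int K)"
    using F_shift_cong[OF x13 K_dvd_2b_mult[OF d4(1) e13(1)]]
      F_shift_cong[OF x1v K_dvd_2b_mult[OF d4(1) e13(2)]]
    by (simp_all add: R_def e_def \<delta>_def algebra_simps)
  have S: "[F (e + 4) = S + 2] (mod int K)" "[F (e + v + 4) = S + 10] (mod int K)"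
    using F_shift_cong[OF x13 K_dvd_2b_mult[OF d4(2) e13(1)]]
      F_shift_cong[OF x1v K_dvd_2b_mult[OF d4(2) e13(2)]]
    by (simp_all add: S_def e_def \<delta>_def algebra_simps)
  have x17: "[F (x1 + w) = 7] (mod int K)"
    using cong_add[OF x1 cong_refl[of 4]] w(2) by (simp add: cong_def)
  have ec: "e mod 4 = 1" using c unfolding e_def \<delta>_def by presburger
  have ev: "(e + v) mod 4 = 1" using ec v(1) by presburger
  have xw: "(x1 + w) mod 4 = 1" using c(1) w(1) by presburger
  have PQRS: "P mod 4 = 1" "Q mod 4 = 1" "R mod 4 = 1" "S mod 4 = 1"
    unfolding P_def Q_def R_def S_def F4 zmod_zminus1_eq_if residue_1_add[OF c(1)] residue_2_add[OF c(2)]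
    by simp_all
  \<comment> \<open>P1 = \<delta>(1 + z)(1 + w^2) + (1 + w), P2 = \<rho>(1 + z^2)(1 + w^2) + 1, P3 =
    \<rho>(1 + z^2)(1 + w) + \<delta>(1 + z).\<close>
  let ?us = "[e, e + 1, e + 4, e + 9, e + v, e + v + 1, e + v + 4, e + v + 9,
      x1, x1 + 2, x1 + 10, x1 + w, x1 + w + 2, x1 + w + 10, x2, x2 + 1, x2 + 5]"
  let ?vs = "[R + 2, P + 1, S + 2, Q + 1, R + 10, P + 9, S + 10, Q + 9,
      2 + 1, P, Q, 2 + 5, P + 4, Q + 4, 2, R, S]"
  have "(\<Sum>i<K. pulses K ?us (int i)) = of_nat (length ?us)" by (rule sum_pulses[OF K_pos])
  also have "\<dots> = 1" by simp
  finally have "(\<Sum>i<K. pulses K ?us (int i)) \<noteq> 0" by (simp only: bit_not_zero_iff)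
  then obtain i where i: "pulses K ?us (int i) \<noteq> 0" by (rule sum.not_neutral_contains_not_neutral)
  show ?thesis
  proof (rule light_wordI[where us = ?us and z = "int i"
        and cs = "[e, e + 4, e + v, e + v + 4, x1, x1 + 1, x1 + 5, x1 + w, x1 + w + 1, x1 + w + 5, x2]"
        and ds = "[P, P + 4, Q, Q + 4, R, R + 1, R + 5, S, S + 1, S + 5, 2]"
        and ya = "[e, e + 5, e + 8, e + 9, e + v, e + v + 5, e + v + 8, e + v + 9,
          x1, x1 + 1, x1 + 4, x1 + 5, x1 + 6, x1 + 9, x1 + 10,
          x1 + w, x1 + w + 1, x1 + w + 4, x1 + w + 5, x1 + w + 6, x1 + w + 9, x1 + w + 10,
          x2, x2 + 4, x2 + 5]"
        and yb = "[P, P + 5, P + 8, P + 9, Q, Q + 5, Q + 8, Q + 9,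
          R, R + 1, R + 4, R + 5, R + 6, R + 9, R + 10,
          S, S + 1, S + 4, S + 5, S + 6, S + 9, S + 10, 2, 2 + 4, 2 + 5]"], goal_cases)
    case (1 c')
    have "\<forall>c \<in> set [e, e + 4, e + v, e + v + 4, x1, x1 + 1, x1 + 5,
          x1 + w, x1 + w + 1, x1 + w + 5, x2]
        \<union> set [P, P + 4, Q, Q + 4, R, R + 1, R + 5, S, S + 1, S + 5, 2]. c mod 4 = 1 \<or> c mod 4 = 2"
      by (simp add: residue_1_add c ec PQRS ev xw)
    then show ?case using 1 by (rule bspec)
  next
    case (3 t)
    have "pulses K (map F ?us) t = pulses K ?vs t"
      using P Q R S x1 x2 x17
      by (intro pulses_cong) (simp add: P_def Q_def R_def S_def)
    also have "\<dots> = pulses K (triple_inputs [P, P + 4, Q, Q + 4, R, R + 1, R + 5, S, S + 1, S + 5, 2]) t"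
      by (simp only: pulses_triples pulses_triple_inputs(1)[of _ 2])
    finally show ?case .
  next
    case 6
    show ?case by (rule i)
  qed (simp_all only: pulses_triples pulses_triple_inputs(1)[of _ x2]
      pulses_triple_parities(1)[of _ x2] pulses_triple_parities(1)[of _ 2], simp)
qed

end

section \<open>From light words to the minimum distance\<close>

lemma minimum_distance_le_of_light_word:
  assumes K: "K = q * k" "K > 0" "4 dvd q" and qpp: "is_QPP K f1 f2"
    and \<pi>: "\<pi> permutes {..<2 * k}" and E: "patch_encoder (2 * k) E"
    and light: "light_word K (int f1) (int f2) w"
  shows "minimum_distance (turbo_code_3D K q (quad_map K f1 f2) \<pi> E) \<le> enat w"
proof -
  interpret quad_perm K "int f1" "int f2" by (rule quad_perm_of_QPP[OF qpp])
  obtain us cs ds ya yb z where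
    classes: "\<And>c. c \<in> set cs \<union> set ds \<Longrightarrow> c mod 4 = 1 \<or> c mod 4 = 2"
    and upper: "\<And>t. pulses K us t = pulses K (triple_inputs cs) t"
    and lower: "\<And>t. pulses K (map F us) t = pulses K (triple_inputs ds) t"
    and par: "\<And>t. pulses K ya t = pulses K (triple_parities cs) t"
      "\<And>t. pulses K yb t = pulses K (triple_parities ds) t"
    and z: "pulses K us z \<noteq> 0"
    and len: "length us + length ya + length yb \<le> w"
    using light unfolding light_word_def by blast
  have tb: "tailbiting_pair K (word K (pulses K us)) (word K (pulses K ya))"
      "tailbiting_pair K (word K (pulses K (map F us))) (word K (pulses K yb))"
    using tailbiting_pair_triples[OF K(2)] by (simp_all add: upper lower par word_def)
  have f_less: "quad_map K f1 f2 i < K" for i using K(2) by (simp add: quad_map_def)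
  have "pulses K (map F us) (int (quad_map K f1 f2 i)) = pulses K us (int i)" for i
    by (rule pulses_map_F[OF cong_sym[OF int_quad_map]])
  then have il: "interleaved K (quad_map K f1 f2) (word K (pulses K us)) (word K (pulses K (map F us)))"
    by (simp add: interleaved_def f_less)
  have "4 dvd K" using K by simp
  then have zero: "word K (pulses K ya) ! i = 0 \<and> word K (pulses K yb) ! i = 0"
    if "i < K" "q dvd i" for i
  proof -
    have "4 dvd int i" using dvd_trans[OF K(3) that(2)] by (metis of_nat_dvd_iff of_nat_numeral)
    then show ?thesis
      using that(1) classes by (simp add: par pulses_triple_parities_eq_0[OF \<open>4 dvd K\<close>])
  qed
  \<comment> \<open>The witness \<open>z\<close> is an arbitrary integer; reading cyclically brings
    it into the range of the word.\<close>
  have "cyc_nth (word K (pulses K us)) z = pulses K us z"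
    by (rule cyc_nth_word[OF K(2) pulses_cong_arg])
  moreover have "cyc_nth (replicate K (0 :: bit)) z = 0"
    using K(2) by (simp add: cyc_nth_def nat_less_iff)
  ultimately have nz: "word K (pulses K us) \<noteq> replicate K 0" using z by metis
  have "weight (word K (pulses K us)) + weight (word K (pulses K ya)) + weight (word K (pulses K yb)) \<le> w"
    using len weight_word_pulses[OF K(2)] by (meson add_mono le_trans)
  moreover have "q \<ge> 1" using K by (cases q) auto
  ultimately show ?thesis
    using turbo_code_minimum_distance_le[OF _ K(1) \<pi> E il tb f_less zero nz] by blast
qed

theorem theorem2:
  fixes K q N f1 f2 :: nat
    and lam :: real
    and \<pi> :: "nat \<Rightarrow> nat"
    and E :: "bit list \<Rightarrow> bit list"
  assumes "K > 0"
    and "lam > 0" and "1 / lam = real q" and "4 dvd q" and "q dvd K"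
    and "multiplicity 2 K \<le> 7"
    and "\<forall>p. prime p \<and> p \<noteq> 2 \<longrightarrow> multiplicity p K \<le> 1"
    and "is_QPP K f1 f2" and "has_quadratic_inverse K f1 f2"
    and "real N = 2 * lam * real K"
    and "\<pi> permutes {..<N}"
    and "patch_encoder N E"
  shows "minimum_distance (turbo_code_3D K q (quad_map K f1 f2) \<pi> E) \<le> 67"
proof -
  obtain k where k: "K = q * k" using \<open>q dvd K\<close> by blast
  have "lam * real q = 1" using assms(2,3) by (simp add: field_simps)
  then have "real N = 2 * real k"
    using assms(10) by (simp add: k algebra_simps)
  then have N: "N = 2 * k" by linarith
  interpret good_quad_perm K "int f1" "int f2"
    using good_quad_perm_of_QPP dvd_trans[OF assms(4,5)] assms(6-9) by blast
  \<comment> \<open>The residue of this sum modulo 4 decides whether the interleaver fixes or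
    exchanges the classes 1 and 3.\<close>
  have "odd (int f1 + int f2)" using odd_a even_b by simp
  then have "(int f1 + int f2) mod 4 = 1 \<or> (int f1 + int f2) mod 4 = 3" by presburger
  then have "light_word K (int f1) (int f2) 67" using light_word_id light_word_swap by blast
  then have "minimum_distance (turbo_code_3D K q (quad_map K f1 f2) \<pi> E) \<le> enat 67"
    using minimum_distance_le_of_light_word[OF k assms(1,4,8)] assms(11,12) N by simp
  then show ?thesis by (simp add: numeral_eq_enat)
qed

end
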